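(* Let $f$ be a transcendental entire function. Then $\dim(I(f)\cap J(f))\leq\operatorname{edim}(f)\leq\dim J(f)$.
   Context: A transcendental entire function is an entire function $f:\mathbb{C}\to\mathbb{C}$ that is not a polynomial. The Julia set $J(f)\subset\mathbb{C}$ is the set of points at which the family of iterates $(f^n)$ is not equicontinuous with respect to the spherical metric (that is, points having no neighbourhood on which the family is equicontinuous). The escaping set is $I(f)=\{z\in\mathbb{C}: f^n(z)\to\infty \text{ as } n\to\infty\}$. The notation $\dim$ denotes Hausdorff dimension (of subsets of $\mathbb{C}$). For $R>0$ let $J_R(f)=\{z\in J(f): |f^n(z)|\geq R \text{ for all } n\geq 1\}$. The eventual dimension of $f$ is $\operatorname{edim}(f)=\inf_{R>0}\dim J_R(f)$. *)

theory Defs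
  imports "HOL-Complex_Analysis.Complex_Analysis"
begin

definition entire :: "(complex \<Rightarrow> complex) \<Rightarrow> bool" where
  "entire f \<longleftrightarrow> f holomorphic_on UNIV"

definition transcendental_entire :: "(complex \<Rightarrow> complex) \<Rightarrow> bool" where
  "transcendental_entire f \<longleftrightarrow> entire f \<and> (\<nexists>p. f = poly p)"

text \<open>Great-circle distance on the unit sphere, transported to the plane by stereographic
  projection; this is the distance induced by the length element \<open>2 |dz| / (1 + |z|\<^sup>2)\<close>.  The
  argument of \<open>arcsin\<close> is half the chordal distance, which lies between 0 and 1.\<close>

definition spherical_dist :: "complex \<Rightarrow> complex \<Rightarrow> real" where
  "spherical_dist z w =
     2 * arcsin (cmod (z - w) / (sqrt (1 + (cmod z)\<^sup>2) * sqrt (1 + (cmod w)\<^sup>2)))"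

definition spherically_equicontinuous_on :: "complex set \<Rightarrow> (complex \<Rightarrow> complex) set \<Rightarrow> bool" where
  "spherically_equicontinuous_on U \<F> \<longleftrightarrow>
     (\<forall>z\<in>U. \<forall>\<epsilon>>0. \<exists>\<delta>>0. \<forall>w\<in>U. spherical_dist z w < \<delta> \<longrightarrow>
        (\<forall>g\<in>\<F>. spherical_dist (g z) (g w) < \<epsilon>))"

definition julia_set :: "(complex \<Rightarrow> complex) \<Rightarrow> complex set" where
  "julia_set f =
     {z. \<not> (\<exists>U. open U \<and> z \<in> U \<and> spherically_equicontinuous_on U {f ^^ n | n. n \<ge> 1})}"

definition escaping_set :: "(complex \<Rightarrow> complex) \<Rightarrow> complex set" where
  "escaping_set f = {z. filterlim (\<lambda>n. (f ^^ n) z) at_infinity sequentially}"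

text \<open>The contribution \<open>(diam U)\<^sup>s\<close> of a set to a covering sum, with the conventions that the
  empty set contributes 0 and that \<open>0\<^sup>0 = 1\<close> for nonempty sets (whereas \<open>0 powr 0 = 0\<close>).\<close>

definition diam_powr :: "real \<Rightarrow> 'a::metric_space set \<Rightarrow> ennreal" where
  "diam_powr s U = (if U = {} then 0 else if s = 0 then 1 else ennreal (diameter U powr s))"

text \<open>Boundedness is required because \<open>diameter\<close> is only meaningful for bounded sets.  Countable
  covers are sequences; finite ones are included by padding with the empty set.\<close>

definition hausdorff_premeasure :: "real \<Rightarrow> real \<Rightarrow> 'a::metric_space set \<Rightarrow> ennreal" where
  "hausdorff_premeasure s \<delta> A =
     (INF U \<in> {U :: nat \<Rightarrow> 'a set. A \<subseteq> (\<Union>i. U i) \<and> (\<forall>i. bounded (U i) \<and> diameter (U i) \<le> \<delta>)}.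
        \<Sum>i. diam_powr s (U i))"

definition hausdorff_measure :: "real \<Rightarrow> 'a::metric_space set \<Rightarrow> ennreal" where
  "hausdorff_measure s A = (SUP \<delta>\<in>{0<..}. hausdorff_premeasure s \<delta> A)"

text \<open>In particular the empty set has dimension 0.\<close>

definition hausdorff_dim :: "'a::metric_space set \<Rightarrow> ennreal" where
  "hausdorff_dim A = (INF s\<in>{s::real. 0 \<le> s \<and> hausdorff_measure s A = 0}. ennreal s)"

definition julia_set_ge :: "real \<Rightarrow> (complex \<Rightarrow> complex) \<Rightarrow> complex set" where
  "julia_set_ge R f = {z \<in> julia_set f. \<forall>n\<ge>1. cmod ((f ^^ n) z) \<ge> R}"

definition eventual_dim :: "(complex \<Rightarrow> complex) \<Rightarrow> ennreal" where
  "eventual_dim f = (INF R\<in>{0<..}. hausdorff_dim (julia_set_ge R f))"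

end

theory Submission
  imports Defs
begin

text \<open>The upper bound on the eventual dimension is monotonicity of Hausdorff dimension.  For the
  lower bound fix \<open>R > 0\<close>.  If \<open>z\<close> is an escaping point of the Julia set, some iterate
  \<open>w = (f ^^ N) z\<close> has a whole orbit outside the disc of radius \<open>R\<close>, and \<open>w\<close> again lies in the
  Julia set, because equicontinuity near \<open>f z\<close> pulls back along the continuous map \<open>f\<close>
  (\<open>julia_set_forward_invariant\<close>).  Hence the escaping part of the Julia set is contained in the
  countable union of the sets \<open>(f ^^ N) -` julia_set_ge R f\<close> (\<open>escaping_julia_subset\<close>).

  It remains to see that preimages under a nonconstant entire function do not raise the
  dimension.  Near a point where the derivative is nonzero the function has a Lipschitz inverse
  (\<open>holomorphic_locally_expanding\<close>), and Lipschitz maps preserve null sets of each Hausdorff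
  measure.  Countably many such neighbourhoods, together with the countable set of critical
  points, exhaust the plane, so the preimage of an \<open>s\<close>-null set is \<open>s\<close>-null for every \<open>s > 0\<close>
  (\<open>hausdorff_measure_eq_0_vimage_entire\<close>).  Null sets are closed under countable unions and
  determine the dimension (\<open>hausdorff_dim_leI\<close>).\<close>

section \<open>Sets of Hausdorff measure zero\<close>

lemma diameter_le_dist:
  fixes S :: "'a::metric_space set"
  assumes "0 \<le> d" "\<And>x y. x \<in> S \<Longrightarrow> y \<in> S \<Longrightarrow> dist x y \<le> d"
  shows "diameter S \<le> d"
  using assms by (auto simp: diameter_def intro!: cSUP_least)

lemma hausdorff_measure_eq_0_iff_premeasure:
  "hausdorff_measure s A = 0 \<longleftrightarrow> (\<forall>\<delta>>0. hausdorff_premeasure s \<delta> A = 0)"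
  using SUP_bot_conv(1)[of "\<lambda>\<delta>. hausdorff_premeasure s \<delta> A" "{0<..}"]
  by (simp add: hausdorff_measure_def bot_ennreal Ball_def)

lemma hausdorff_premeasure_eq_0D:
  assumes "hausdorff_premeasure s \<delta> A = 0" "\<epsilon> > 0"
  obtains U :: "nat \<Rightarrow> 'a::metric_space set"
  where "A \<subseteq> (\<Union>i. U i)" "\<And>i. bounded (U i)" "\<And>i. diameter (U i) \<le> \<delta>"
    "(\<Sum>i. diam_powr s (U i)) \<le> ennreal \<epsilon>"
proof -
  have "hausdorff_premeasure s \<delta> A < ennreal \<epsilon>" using assms by simp
  then show thesis
    unfolding hausdorff_premeasure_def INF_less_iff using that less_imp_le by blast
qed

text \<open>For a positive exponent the mesh condition in the Hausdorff measure takes care of itself: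
  when the whole covering sum is at most \<open>\<delta> powr s\<close>, each member of the cover has diameter at
  most \<open>\<delta>\<close>.\<close>

lemma hausdorff_measure_eq_0_iff_small_covers:
  fixes A :: "'a::metric_space set"
  assumes "s > 0"
  shows "hausdorff_measure s A = 0 \<longleftrightarrow>
    (\<forall>\<epsilon>>0. \<exists>U :: nat \<Rightarrow> 'a set. A \<subseteq> (\<Union>i. U i) \<and> (\<forall>i. bounded (U i)) \<and>
      (\<Sum>i. diam_powr s (U i)) \<le> ennreal \<epsilon>)" (is "?L \<longleftrightarrow> ?R")
proof
  assume ?L
  then have "hausdorff_premeasure s 1 A = 0"
    by (simp add: hausdorff_measure_eq_0_iff_premeasure)
  then show ?R by (metis hausdorff_premeasure_eq_0D)
next
  assume R: ?R
  have "hausdorff_premeasure s \<delta> A \<le> 0 + ennreal \<epsilon>" if "\<delta> > 0" "\<epsilon> > 0" for \<delta> \<epsilon> :: real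
  proof -
    define \<eta> where "\<eta> = min \<epsilon> (\<delta> powr s)"
    have "\<eta> > 0" using that by (simp add: \<eta>_def)
    then obtain U :: "nat \<Rightarrow> 'a set"
      where U: "A \<subseteq> (\<Union>i. U i)" "\<And>i. bounded (U i)"
        and sum_le: "(\<Sum>i. diam_powr s (U i)) \<le> ennreal \<eta>"
      using R by metis
    have "diameter (U i) \<le> \<delta>" for i
    proof (cases "U i = {}")
      case False
      have "diam_powr s (U i) \<le> (\<Sum>i. diam_powr s (U i))"
        using sum_le_suminf[OF summableI, of "{i}" "\<lambda>i. diam_powr s (U i)"] by simp
      also note sum_le
      finally have "diameter (U i) powr s \<le> \<delta> powr s"
        using False assms \<open>\<eta> > 0\<close> by (simp add: diam_powr_def \<eta>_def ennreal_le_iff)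
      then show ?thesis
        using powr_less_mono2[of s \<delta> "diameter (U i)"] assms that by linarith
    qed (use that in simp)
    then have "hausdorff_premeasure s \<delta> A \<le> (\<Sum>i. diam_powr s (U i))"
      unfolding hausdorff_premeasure_def using U by (intro INF_lower) auto
    also have "\<dots> \<le> ennreal \<epsilon>"
      using sum_le by (rule order_trans) (simp add: \<eta>_def ennreal_leI)
    finally show ?thesis by simp
  qed
  then show ?L
    unfolding hausdorff_measure_eq_0_iff_premeasure
    by (metis ennreal_le_epsilon le_zero_eq)
qed

lemma hausdorff_measure_eq_0_subset:
  fixes A B :: "'a::metric_space set"
  assumes "s > 0" "hausdorff_measure s B = 0" "A \<subseteq> B"
  shows "hausdorff_measure s A = 0"
  using assms unfolding hausdorff_measure_eq_0_iff_small_covers[OF \<open>s > 0\<close>]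
  by (meson subset_trans)

text \<open>Covers of mesh at most 1 only profit from a larger exponent; this includes the exponent 0,
  where every nonempty set of the cover contributes 1.\<close>

lemma hausdorff_measure_eq_0_mono_exponent:
  fixes A :: "'a::metric_space set"
  assumes "0 \<le> s" "s < t" "hausdorff_measure s A = 0"
  shows "hausdorff_measure t A = 0"
proof -
  have le: "diam_powr t U \<le> diam_powr s U" if "bounded U" "diameter U \<le> 1" for U :: "'a set"
    using assms that diameter_ge_0[OF that(1)]
    by (auto simp: diam_powr_def powr_le1 intro!: ennreal_leI powr_mono')
  have "\<exists>U :: nat \<Rightarrow> 'a set. A \<subseteq> (\<Union>i. U i) \<and> (\<forall>i. bounded (U i)) \<and>
      (\<Sum>i. diam_powr t (U i)) \<le> ennreal \<epsilon>" if "\<epsilon> > 0" for \<epsilon>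
  proof -
    have "hausdorff_premeasure s 1 A = 0"
      using assms by (simp add: hausdorff_measure_eq_0_iff_premeasure)
    then obtain U :: "nat \<Rightarrow> 'a set"
      where U: "A \<subseteq> (\<Union>i. U i)" "\<And>i. bounded (U i)" "\<And>i. diameter (U i) \<le> 1"
        and "(\<Sum>i. diam_powr s (U i)) \<le> ennreal \<epsilon>"
      using hausdorff_premeasure_eq_0D \<open>\<epsilon> > 0\<close> by metis
    moreover have "(\<Sum>i. diam_powr t (U i)) \<le> (\<Sum>i. diam_powr s (U i))"
      using U le by (intro suminf_le) auto
    ultimately show ?thesis by (meson order_trans)
  qed
  then show ?thesis
    using assms by (subst hausdorff_measure_eq_0_iff_small_covers) auto
qed

lemma hausdorff_measure_eq_0_UN_nat:
  fixes A :: "nat \<Rightarrow> 'a::metric_space set"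
  assumes s: "s > 0" and null: "\<And>n. hausdorff_measure s (A n) = 0"
  shows "hausdorff_measure s (\<Union>n. A n) = 0"
  unfolding hausdorff_measure_eq_0_iff_small_covers[OF s]
proof (intro allI impI)
  fix \<epsilon> :: real assume "\<epsilon> > 0"
  then have "\<exists>U :: nat \<Rightarrow> 'a set. A n \<subseteq> (\<Union>i. U i) \<and> (\<forall>i. bounded (U i)) \<and>
      (\<Sum>i. diam_powr s (U i)) \<le> ennreal (\<epsilon> * (1/2) ^ Suc n)" for n
    using null[of n] unfolding hausdorff_measure_eq_0_iff_small_covers[OF s] by simp
  then obtain U :: "nat \<Rightarrow> nat \<Rightarrow> 'a set"
    where U: "\<And>n. A n \<subseteq> (\<Union>i. U n i)" "\<And>n i. bounded (U n i)"
      and sum_le: "\<And>n. (\<Sum>i. diam_powr s (U n i)) \<le> ennreal (\<epsilon> * (1/2) ^ Suc n)"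
    by metis
  define V where "V = (\<lambda>k. case prod_decode k of (n, i) \<Rightarrow> U n i)"
  have "(\<Sum>k. diam_powr s (V k)) = (\<Sum>n i. diam_powr s (U n i))"
    using suminf_ennreal_2dimen[of "\<lambda>n. \<Sum>i. diam_powr s (U n i)"
        "\<lambda>(n, i). diam_powr s (U n i)"]
    by (simp add: V_def case_prod_unfold)
  also have "\<dots> \<le> (\<Sum>n. ennreal (\<epsilon> * (1/2) ^ Suc n))"
    by (intro suminf_le sum_le) auto
  also have "\<dots> = ennreal (\<epsilon> * 1)"
    using \<open>\<epsilon> > 0\<close> by (intro suminf_ennreal_eq sums_mult power_half_series) auto
  finally have "(\<Sum>k. diam_powr s (V k)) \<le> ennreal \<epsilon>" by simp
  moreover have "(\<Union>n. A n) \<subseteq> (\<Union>k. V k)"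
  proof
    fix x assume "x \<in> (\<Union>n. A n)"
    then obtain n i where "x \<in> U n i" using U(1) by blast
    then have "x \<in> V (prod_encode (n, i))" by (simp add: V_def)
    then show "x \<in> (\<Union>k. V k)" by blast
  qed
  moreover have "bounded (V k)" for k
    using U(2) by (simp add: V_def case_prod_unfold)
  ultimately show "\<exists>U :: nat \<Rightarrow> 'a set. (\<Union>n. A n) \<subseteq> (\<Union>i. U i) \<and> (\<forall>i. bounded (U i)) \<and>
      (\<Sum>i. diam_powr s (U i)) \<le> ennreal \<epsilon>" by blast
qed

lemma hausdorff_measure_empty:
  "s > 0 \<Longrightarrow> hausdorff_measure s ({} :: 'a::metric_space set) = 0"
  by (subst hausdorff_measure_eq_0_iff_small_covers)
    (auto simp: diam_powr_def intro!: exI[of _ "\<lambda>_. {}"])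

lemma hausdorff_measure_eq_0_Union:
  fixes \<A> :: "'a::metric_space set set"
  assumes "s > 0" "countable \<A>" "\<And>A. A \<in> \<A> \<Longrightarrow> hausdorff_measure s A = 0"
  shows "hausdorff_measure s (\<Union>\<A>) = 0"
proof (cases "\<A> = {}")
  case False
  then have "\<Union>\<A> = (\<Union>n. from_nat_into \<A> n)"
    using range_from_nat_into[OF False assms(2)] by simp
  then show ?thesis
    using hausdorff_measure_eq_0_UN_nat[of s "from_nat_into \<A>"] assms from_nat_into[OF False]
    by simp
qed (simp add: hausdorff_measure_empty assms)

lemma hausdorff_measure_eq_0_Un:
  fixes A B :: "'a::metric_space set"
  assumes "s > 0" "hausdorff_measure s A = 0" "hausdorff_measure s B = 0"
  shows "hausdorff_measure s (A \<union> B) = 0"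
  using hausdorff_measure_eq_0_Union[of s "{A, B}"] assms by auto

lemma hausdorff_measure_eq_0_countable:
  fixes A :: "'a::metric_space set"
  assumes "s > 0" "countable A"
  shows "hausdorff_measure s A = 0"
proof -
  have "hausdorff_measure s {x} = 0" for x :: 'a
    unfolding hausdorff_measure_eq_0_iff_small_covers[OF \<open>s > 0\<close>]
    using \<open>s > 0\<close> by (auto simp: diam_powr_def intro!: exI[of _ "\<lambda>_. {x}"])
  then show ?thesis
    using hausdorff_measure_eq_0_Union[of s "(\<lambda>x. {x}) ` A"] assms by auto
qed

text \<open>A map that expands distances at least by the factor \<open>c\<close> has an inverse that is Lipschitz with
  constant \<open>1/c\<close>, so pulling back a cover changes its sum at most by the factor \<open>c powr - s\<close>.\<close>

lemma hausdorff_measure_eq_0_vimage_expanding: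
  fixes g :: "'a::metric_space \<Rightarrow> 'b::metric_space"
  assumes s: "s > 0" and null: "hausdorff_measure s A = 0" and c: "c > 0"
    and expand: "\<And>x y. x \<in> S \<Longrightarrow> y \<in> S \<Longrightarrow> c * dist x y \<le> dist (g x) (g y)"
  shows "hausdorff_measure s (S \<inter> g -` A) = 0"
  unfolding hausdorff_measure_eq_0_iff_small_covers[OF s]
proof (intro allI impI)
  fix \<epsilon> :: real assume "\<epsilon> > 0"
  then have "\<epsilon> * c powr s > 0" using c by simp
  then obtain U :: "nat \<Rightarrow> 'b set"
    where U: "A \<subseteq> (\<Union>i. U i)" "\<And>i. bounded (U i)"
      and sum_le: "(\<Sum>i. diam_powr s (U i)) \<le> ennreal (\<epsilon> * c powr s)"
    using null unfolding hausdorff_measure_eq_0_iff_small_covers[OF s] by metis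
  define V where "V = (\<lambda>i. S \<inter> g -` U i)"
  have dist_le: "dist x y \<le> diameter (U i) / c" if "x \<in> V i" "y \<in> V i" for x y i
  proof -
    have "c * dist x y \<le> dist (g x) (g y)" using that expand by (auto simp: V_def)
    also have "\<dots> \<le> diameter (U i)"
      using that U(2) by (intro diameter_bounded_bound) (auto simp: V_def)
    finally show ?thesis using c by (simp add: field_simps)
  qed
  have bounded: "bounded (V i)" for i using dist_le bounded_two_points by blast
  have diam_le: "diam_powr s (V i) \<le> ennreal (c powr - s) * diam_powr s (U i)" for i
  proof (cases "V i = {}")
    case False
    then have "U i \<noteq> {}" by (auto simp: V_def)
    have "diameter (V i) \<le> diameter (U i) / c"
      using dist_le c diameter_ge_0[OF U(2)] by (intro diameter_le_dist) auto
    then have "diameter (V i) powr s \<le> (diameter (U i) / c) powr s"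
      using s diameter_ge_0[OF bounded] by (intro powr_mono2) auto
    also have "\<dots> = c powr - s * diameter (U i) powr s"
      using c diameter_ge_0[OF U(2)] by (simp add: powr_divide powr_minus field_simps)
    finally show ?thesis
      using False \<open>U i \<noteq> {}\<close> s by (simp add: diam_powr_def ennreal_leI flip: ennreal_mult)
  qed (simp add: diam_powr_def)
  have "(\<Sum>i. diam_powr s (V i)) \<le> (\<Sum>i. ennreal (c powr - s) * diam_powr s (U i))"
    by (intro suminf_le diam_le) auto
  also have "\<dots> = ennreal (c powr - s) * (\<Sum>i. diam_powr s (U i))" by simp
  also have "\<dots> \<le> ennreal (c powr - s) * ennreal (\<epsilon> * c powr s)"
    by (intro mult_left_mono sum_le) auto
  also have "\<dots> = ennreal \<epsilon>"
    using c \<open>\<epsilon> > 0\<close> by (simp add: powr_minus flip: ennreal_mult)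
  finally have "(\<Sum>i. diam_powr s (V i)) \<le> ennreal \<epsilon>" .
  moreover have "S \<inter> g -` A \<subseteq> (\<Union>i. V i)" using U(1) unfolding V_def by blast
  ultimately show "\<exists>U :: nat \<Rightarrow> 'a set. S \<inter> g -` A \<subseteq> (\<Union>i. U i) \<and> (\<forall>i. bounded (U i)) \<and>
      (\<Sum>i. diam_powr s (U i)) \<le> ennreal \<epsilon>" using bounded by blast
qed

text \<open>Dimensions can be compared through null sets of positive exponent only.  The value
  \<open>s = 0\<close>, where null means empty, is recovered as a limit of positive exponents.\<close>

lemma hausdorff_dim_leI:
  fixes A :: "'a::metric_space set" and B :: "'b::metric_space set"
  assumes "\<And>s. s > 0 \<Longrightarrow> hausdorff_measure s A = 0 \<Longrightarrow> hausdorff_measure s B = 0"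
  shows "hausdorff_dim B \<le> hausdorff_dim A"
proof -
  have "hausdorff_dim B \<le> ennreal s" if "0 \<le> s" "hausdorff_measure s A = 0" for s
  proof (rule ennreal_le_epsilon)
    fix e :: real assume "0 < e"
    then have "hausdorff_measure (s + e) B = 0"
      using that assms hausdorff_measure_eq_0_mono_exponent[of s "s + e" A] by simp
    then have "hausdorff_dim B \<le> ennreal (s + e)"
      unfolding hausdorff_dim_def using that \<open>0 < e\<close> by (intro INF_lower) auto
    then show "hausdorff_dim B \<le> ennreal s + ennreal e"
      using that \<open>0 < e\<close> by simp
  qed
  then show ?thesis
    unfolding hausdorff_dim_def[of A] by (intro INF_greatest) auto
qed

section \<open>Preimages under entire functions\<close>

text \<open>On a small disc around \<open>z\<close> the derivative stays within \<open>cmod (deriv g z) / 2\<close> of its value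
  at the centre, so \<open>g\<close> differs from the linear map \<open>w \<mapsto> deriv g z * w\<close> by a function
  with that Lipschitz constant, which leaves the other half as an expansion factor.\<close>

lemma holomorphic_locally_expanding:
  assumes holo: "g holomorphic_on UNIV" and nz: "deriv g z \<noteq> 0"
  obtains r c where "r > 0" "c > 0"
    "\<And>x y. x \<in> ball z r \<Longrightarrow> y \<in> ball z r \<Longrightarrow> c * dist x y \<le> dist (g x) (g y)"
proof -
  define a c where "a = deriv g z" and "c = cmod a / 2"
  have "c > 0" using nz by (simp add: c_def a_def)
  have "isCont (deriv g) z"
    using holomorphic_on_imp_continuous_on[OF holomorphic_deriv[OF holo]]
    by (simp add: continuous_on_eq_continuous_at)
  then obtain r where "r > 0" and r: "\<And>w. dist w z < r \<Longrightarrow> dist (deriv g w) a < c"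
    using \<open>c > 0\<close> by (auto simp: continuous_at_eps_delta a_def)
  have "c * dist x y \<le> dist (g x) (g y)" if "x \<in> ball z r" "y \<in> ball z r" for x y
  proof -
    have "cmod ((g x - a * x) - (g y - a * y)) \<le> c * cmod (x - y)"
    proof (rule field_differentiable_bound[OF _ _ _ that])
      fix w assume w: "w \<in> ball z r"
      have "(g has_field_derivative deriv g w) (at w)"
        using holo by (auto intro: holomorphic_derivI)
      then have "((\<lambda>w. g w - a * w) has_field_derivative deriv g w - a) (at w)"
        by (auto intro!: derivative_eq_intros)
      then show "((\<lambda>w. g w - a * w) has_field_derivative deriv g w - a) (at w within ball z r)"
        by (rule has_field_derivative_at_within)
      show "cmod (deriv g w - a) \<le> c"
        using r[of w] w by (simp add: dist_norm norm_minus_commute)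
    qed simp
    moreover have "cmod (a * (x - y)) \<le>
        cmod (g x - g y) + cmod ((g x - a * x) - (g y - a * y))"
      using norm_triangle_ineq4[of "g x - g y" "(g x - a * x) - (g y - a * y)"]
      by (simp add: algebra_simps)
    moreover have "cmod (a * (x - y)) = 2 * c * cmod (x - y)"
      by (simp add: norm_mult c_def)
    ultimately show ?thesis by (simp add: dist_norm)
  qed
  with \<open>r > 0\<close> \<open>c > 0\<close> show thesis by (rule that)
qed

text \<open>Away from the critical points the preimage splits into countably many pieces on which \<open>g\<close>
  has a Lipschitz inverse; the critical points themselves form a countable set.\<close>

lemma hausdorff_measure_eq_0_vimage_entire:
  assumes s: "s > 0" and null: "hausdorff_measure s A = 0"
    and holo: "g holomorphic_on UNIV" and nonconst: "\<not> g constant_on UNIV"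
  shows "hausdorff_measure s (g -` A) = 0"
proof -
  define \<F> where "\<F> = {ball z r | z r. r > 0 \<and> hausdorff_measure s (ball z r \<inter> g -` A) = 0}"
  obtain \<G> where \<G>: "\<G> \<subseteq> \<F>" "countable \<G>" "\<Union>\<G> = \<Union>\<F>"
  proof (rule Lindelof)
    show "open S" if "S \<in> \<F>" for S using that by (auto simp: \<F>_def)
  qed
  have noncritical: "z \<in> \<Union>\<G>" if nz: "deriv g z \<noteq> 0" for z
  proof -
    obtain r c where "r > 0" "c > 0"
      "\<And>x y. x \<in> ball z r \<Longrightarrow> y \<in> ball z r \<Longrightarrow> c * dist x y \<le> dist (g x) (g y)"
      using holomorphic_locally_expanding[OF holo nz] by metis
    then have "hausdorff_measure s (ball z r \<inter> g -` A) = 0"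
      using hausdorff_measure_eq_0_vimage_expanding[OF s null] by blast
    then have "ball z r \<in> \<F>" unfolding \<F>_def using \<open>r > 0\<close> by blast
    then show ?thesis unfolding \<G>(3) using \<open>r > 0\<close> by (intro UnionI[of "ball z r"]) auto
  qed
  have deriv0: "g constant_on UNIV" if "\<And>z. deriv g z = 0"
  proof -
    have "(g has_field_derivative 0) (at z)" for z
      using holomorphic_derivI[OF holo, of z UNIV] that by simp
    then show ?thesis
      using has_field_derivative_zero_constant[of UNIV g] by (simp add: constant_on_def)
  qed
  have "countable {z \<in> UNIV. deriv g z = 0}"
  proof (cases "deriv g constant_on UNIV")
    case True
    \<comment> \<open>A constant derivative is a nonzero constant, and there are no critical points.\<close>
    then have "{z \<in> UNIV. deriv g z = 0} = {}"
      using deriv0 nonconst by (auto simp: constant_on_def)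
    then show ?thesis by simp
  next
    case False
    then show ?thesis
      by (intro holomorphic_countable_zeros holomorphic_deriv[OF holo]) auto
  qed
  then have "hausdorff_measure s {z. deriv g z = 0} = 0"
    using hausdorff_measure_eq_0_countable[OF s] by simp
  moreover have "hausdorff_measure s (\<Union>((\<lambda>B. B \<inter> g -` A) ` \<G>)) = 0"
    using \<G> by (intro hausdorff_measure_eq_0_Union[OF s]) (auto simp: \<F>_def)
  moreover have "g -` A \<subseteq> {z. deriv g z = 0} \<union> \<Union>((\<lambda>B. B \<inter> g -` A) ` \<G>)"
    using noncritical by blast
  ultimately show ?thesis
    by (meson hausdorff_measure_eq_0_Un[OF s] hausdorff_measure_eq_0_subset[OF s])
qed

lemma hausdorff_measure_eq_0_vimage_funpow:
  assumes "s > 0" "hausdorff_measure s A = 0"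
    and "g holomorphic_on UNIV" "\<not> g constant_on UNIV"
  shows "hausdorff_measure s ((g ^^ n) -` A) = 0"
proof (induction n)
  case (Suc n)
  have "(g ^^ Suc n) -` A = g -` ((g ^^ n) -` A)"
    by (simp add: funpow_Suc_right vimage_comp del: funpow.simps)
  then show ?case
    by (simp only: hausdorff_measure_eq_0_vimage_entire[OF assms(1) Suc.IH assms(3,4)])
qed (use assms in simp)

lemma transcendental_entire_not_constant:
  assumes "transcendental_entire f"
  shows "\<not> f constant_on UNIV"
proof
  assume "f constant_on UNIV"
  then obtain c where "\<And>z. f z = c" by (auto simp: constant_on_def)
  then have "f = poly [:c:]" by auto
  then show False using assms by (auto simp: transcendental_entire_def)
qed

section \<open>Forward invariance of the Julia set\<close>

lemma half_chordal_le_1: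
  "cmod (z - w) / (sqrt (1 + (cmod z)\<^sup>2) * sqrt (1 + (cmod w)\<^sup>2)) \<le> 1"
proof -
  have "(cmod (z - w))\<^sup>2 \<le> (cmod z + cmod w)\<^sup>2"
    by (intro power_mono norm_triangle_ineq4) auto
  also have "\<dots> \<le> (cmod z + cmod w)\<^sup>2 + (1 - cmod z * cmod w)\<^sup>2"
    by simp
  also have "\<dots> = (1 + (cmod z)\<^sup>2) * (1 + (cmod w)\<^sup>2)"
    by (simp add: power2_eq_square algebra_simps)
  finally have "cmod (z - w) \<le> sqrt ((1 + (cmod z)\<^sup>2) * (1 + (cmod w)\<^sup>2))"
    by (rule real_le_rsqrt)
  moreover have "sqrt (1 + (cmod z)\<^sup>2) * sqrt (1 + (cmod w)\<^sup>2) > 0"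
    by (intro mult_pos_pos) (auto simp: add_pos_nonneg)
  ultimately show ?thesis by (simp add: real_sqrt_mult)
qed

lemma spherical_dist_tendsto_0:
  assumes "isCont g z"
  shows "((\<lambda>w. spherical_dist (g z) (g w)) \<longlongrightarrow> 0) (at z)"
proof -
  have nz: "sqrt (1 + (cmod u)\<^sup>2) \<noteq> 0" for u
    by (metis add_pos_nonneg less_irrefl real_sqrt_gt_zero zero_le_power2 zero_less_one)
  have "((\<lambda>w. cmod (g z - g w) / (sqrt (1 + (cmod (g z))\<^sup>2) * sqrt (1 + (cmod (g w))\<^sup>2)))
      \<longlongrightarrow> cmod (g z - g z) / (sqrt (1 + (cmod (g z))\<^sup>2) * sqrt (1 + (cmod (g z))\<^sup>2))) (at z)"
    using assms nz unfolding isCont_def by (intro tendsto_intros) auto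
  then have "((\<lambda>w. 2 * arcsin (cmod (g z - g w) /
      (sqrt (1 + (cmod (g z))\<^sup>2) * sqrt (1 + (cmod (g w))\<^sup>2)))) \<longlongrightarrow> 2 * arcsin 0) (at z)"
    by (intro tendsto_mult tendsto_const isCont_tendsto_compose[OF isCont_arcsin]) auto
  then show ?thesis by (simp add: spherical_dist_def)
qed

text \<open>On bounded sets the spherical metric dominates a multiple of the Euclidean one; the chord
  is no longer than the arc.\<close>

lemma norm_diff_le_spherical_dist:
  assumes "cmod z \<le> M" "cmod w \<le> M"
  shows "cmod (z - w) \<le> (1 + M\<^sup>2) * spherical_dist z w"
proof -
  define d where "d = sqrt (1 + (cmod z)\<^sup>2) * sqrt (1 + (cmod w)\<^sup>2)"
  define q where "q = cmod (z - w) / d"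
  have "d > 0" unfolding d_def by (intro mult_pos_pos) (auto simp: add_pos_nonneg)
  have q: "0 \<le> q" "q \<le> 1"
    using \<open>d > 0\<close> half_chordal_le_1[of z w] by (auto simp: q_def d_def)
  have "q = sin (arcsin q)" using q by simp
  also have "\<dots> \<le> arcsin q" using q by (intro sin_x_le_x arcsin_nonneg) auto
  also have "\<dots> \<le> 2 * arcsin q" using arcsin_nonneg[of q] q by simp
  finally have "q \<le> spherical_dist z w" by (simp add: spherical_dist_def q_def d_def)
  have "sqrt (1 + (cmod u)\<^sup>2) \<le> sqrt (1 + M\<^sup>2)" if "cmod u \<le> M" for u
    using that by (simp add: power_mono)
  then have "d \<le> sqrt (1 + M\<^sup>2) * sqrt (1 + M\<^sup>2)"
    using assms unfolding d_def by (intro mult_mono) auto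
  then have "d \<le> 1 + M\<^sup>2" by simp
  have "cmod (z - w) = d * q" using \<open>d > 0\<close> by (simp add: q_def)
  also have "\<dots> \<le> (1 + M\<^sup>2) * spherical_dist z w"
    using \<open>d \<le> 1 + M\<^sup>2\<close> \<open>q \<le> spherical_dist z w\<close> q by (intro mult_mono) auto
  finally show ?thesis .
qed

lemma continuous_spherical_dist:
  assumes cont: "isCont g z" and M: "cmod z < M" and "\<epsilon> > 0"
  obtains \<delta> where "\<delta> > 0"
    "\<And>w. cmod w < M \<Longrightarrow> spherical_dist z w < \<delta> \<Longrightarrow> spherical_dist (g z) (g w) < \<epsilon>"
proof -
  have "eventually (\<lambda>w. spherical_dist (g z) (g w) < \<epsilon>) (at z)"
    using order_tendstoD(2)[OF spherical_dist_tendsto_0[OF cont] \<open>\<epsilon> > 0\<close>] .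
  then obtain \<eta> where "\<eta> > 0" and
    \<eta>: "\<And>w. w \<noteq> z \<Longrightarrow> dist w z < \<eta> \<Longrightarrow> spherical_dist (g z) (g w) < \<epsilon>"
    unfolding eventually_at by auto
  have pos: "1 + M\<^sup>2 > 0" by (simp add: add_pos_nonneg)
  show thesis
  proof
    show "\<eta> / (1 + M\<^sup>2) > 0" using \<open>\<eta> > 0\<close> pos by simp
    fix w assume w: "cmod w < M" "spherical_dist z w < \<eta> / (1 + M\<^sup>2)"
    have "cmod (z - w) \<le> (1 + M\<^sup>2) * spherical_dist z w"
      using w M by (intro norm_diff_le_spherical_dist) auto
    also have "\<dots> < \<eta>" using w(2) pos by (simp add: field_simps)
    finally have "dist w z < \<eta>" by (simp add: dist_norm norm_minus_commute)
    then show "spherical_dist (g z) (g w) < \<epsilon>"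
      using \<eta>[of w] \<open>\<epsilon> > 0\<close> by (cases "w = z") (auto simp: spherical_dist_def)
  qed
qed

text \<open>If the iterates are equicontinuous near \<open>f z\<close>, composing them with the continuous map \<open>f\<close>
  gives all iterates except \<open>f\<close> itself near \<open>z\<close>, and adding one continuous function to a family
  does not destroy equicontinuity.  Intersecting with a disc about the origin makes the spherical
  and Euclidean notions of nearness comparable.\<close>

lemma julia_set_forward_invariant:
  assumes cont: "continuous_on UNIV f" and z: "z \<in> julia_set f"
  shows "f z \<in> julia_set f"
proof (rule ccontr)
  assume "f z \<notin> julia_set f"
  then obtain U where U: "open U" "f z \<in> U"
    and equi: "spherically_equicontinuous_on U {f ^^ n | n. n \<ge> 1}"
    by (auto simp: julia_set_def)
  have isCont: "isCont f x" for x using cont by (simp add: continuous_on_eq_continuous_at)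
  define M where "M = cmod z + 1"
  define V where "V = f -` U \<inter> ball 0 M"
  have "open V" using open_vimage[OF U(1) cont] by (simp add: V_def open_Int)
  moreover have "z \<in> V" using U by (simp add: V_def M_def)
  moreover have "spherically_equicontinuous_on V {f ^^ n | n. n \<ge> 1}"
    unfolding spherically_equicontinuous_on_def
  proof (intro ballI allI impI)
    fix x and \<epsilon> :: real assume x: "x \<in> V" and "\<epsilon> > 0"
    then have "f x \<in> U" "cmod x < M" by (auto simp: V_def)
    obtain \<delta>\<^sub>0 where "\<delta>\<^sub>0 > 0" and \<delta>\<^sub>0: "\<And>y n. y \<in> U \<Longrightarrow> spherical_dist (f x) y < \<delta>\<^sub>0 \<Longrightarrow>
        n \<ge> 1 \<Longrightarrow> spherical_dist ((f ^^ n) (f x)) ((f ^^ n) y) < \<epsilon>"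
    proof -
      have "\<exists>\<delta>>0. \<forall>w\<in>U. spherical_dist (f x) w < \<delta> \<longrightarrow>
          (\<forall>h\<in>{f ^^ n | n. n \<ge> 1}. spherical_dist (h (f x)) (h w) < \<epsilon>)"
        using equi \<open>f x \<in> U\<close> \<open>\<epsilon> > 0\<close> unfolding spherically_equicontinuous_on_def by blast
      then show thesis using that by blast
    qed
    obtain \<delta> where "\<delta> > 0" and \<delta>: "\<And>w. cmod w < M \<Longrightarrow> spherical_dist x w < \<delta> \<Longrightarrow>
        spherical_dist (f x) (f w) < min \<epsilon> \<delta>\<^sub>0"
      using continuous_spherical_dist[OF isCont \<open>cmod x < M\<close>, of "min \<epsilon> \<delta>\<^sub>0"]
        \<open>\<epsilon> > 0\<close> \<open>\<delta>\<^sub>0 > 0\<close> by auto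
    have "spherical_dist ((f ^^ n) x) ((f ^^ n) w) < \<epsilon>"
      if "w \<in> V" "spherical_dist x w < \<delta>" "n \<ge> 1" for w n
    proof -
      have w: "f w \<in> U" "spherical_dist (f x) (f w) < min \<epsilon> \<delta>\<^sub>0"
        using that \<delta>[of w] by (auto simp: V_def)
      obtain m where m: "n = Suc m" using \<open>n \<ge> 1\<close> by (cases n) auto
      show ?thesis
      proof (cases m)
        case 0
        then show ?thesis using w m by simp
      next
        case (Suc k)
        then show ?thesis
          using \<delta>\<^sub>0[of "f w" m] w by (simp add: m funpow_Suc_right del: funpow.simps)
      qed
    qed
    then show "\<exists>\<delta>>0. \<forall>w\<in>V. spherical_dist x w < \<delta> \<longrightarrow>
        (\<forall>g\<in>{f ^^ n | n. n \<ge> 1}. spherical_dist (g x) (g w) < \<epsilon>)"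
      using \<open>\<delta> > 0\<close> by blast
  qed
  ultimately show False using z unfolding julia_set_def by blast
qed

lemma julia_set_funpow:
  assumes "continuous_on UNIV f" "z \<in> julia_set f"
  shows "(f ^^ n) z \<in> julia_set f"
  by (induction n) (auto simp: assms julia_set_forward_invariant)

section \<open>The eventual dimension\<close>

text \<open>An escaping orbit leaves the disc of radius \<open>R\<close> for good after some time \<open>N\<close>, and by then
  it is still in the Julia set.\<close>

lemma escaping_julia_subset:
  assumes "continuous_on UNIV f"
  shows "escaping_set f \<inter> julia_set f \<subseteq> (\<Union>N. (f ^^ N) -` julia_set_ge R f)"
proof
  fix z assume z: "z \<in> escaping_set f \<inter> julia_set f"
  then have "eventually (\<lambda>n. cmod ((f ^^ n) z) \<ge> R) sequentially"
    by (auto simp: escaping_set_def filterlim_at_infinity_conv_norm_at_top filterlim_at_top)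
  then obtain N where N: "\<And>n. n \<ge> N \<Longrightarrow> cmod ((f ^^ n) z) \<ge> R"
    by (auto simp: eventually_sequentially)
  have "cmod ((f ^^ n) ((f ^^ N) z)) \<ge> R" for n
    using N[of "n + N"] by (simp add: funpow_add)
  then have "(f ^^ N) z \<in> julia_set_ge R f"
    using julia_set_funpow[OF assms] z by (simp add: julia_set_ge_def)
  then show "z \<in> (\<Union>N. (f ^^ N) -` julia_set_ge R f)" by blast
qed

theorem lemma5p1:
  fixes f :: "complex \<Rightarrow> complex"
  assumes "transcendental_entire f"
  shows "hausdorff_dim (escaping_set f \<inter> julia_set f) \<le> eventual_dim f
       \<and> eventual_dim f \<le> hausdorff_dim (julia_set f)"
proof
  have holo: "f holomorphic_on UNIV"
    using assms by (simp add: transcendental_entire_def entire_def)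
  then have cont: "continuous_on UNIV f" by (rule holomorphic_on_imp_continuous_on)
  note nonconst = transcendental_entire_not_constant[OF assms]
  show "hausdorff_dim (escaping_set f \<inter> julia_set f) \<le> eventual_dim f"
    unfolding eventual_dim_def
  proof (intro INF_greatest hausdorff_dim_leI)
    fix R s :: real assume s: "s > 0" "hausdorff_measure s (julia_set_ge R f) = 0"
    have "hausdorff_measure s (\<Union>N. (f ^^ N) -` julia_set_ge R f) = 0"
      by (intro hausdorff_measure_eq_0_UN_nat s(1)
          hausdorff_measure_eq_0_vimage_funpow[OF s holo nonconst])
    then show "hausdorff_measure s (escaping_set f \<inter> julia_set f) = 0"
      by (rule hausdorff_measure_eq_0_subset[OF s(1) _ escaping_julia_subset[OF cont]])
  qed
  have "eventual_dim f \<le> hausdorff_dim (julia_set_ge 1 f)"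
    unfolding eventual_dim_def by (intro INF_lower) simp
  also have "\<dots> \<le> hausdorff_dim (julia_set f)"
    by (rule hausdorff_dim_leI, rule hausdorff_measure_eq_0_subset[where B = "julia_set f"])
      (auto simp: julia_set_ge_def)
  finally show "eventual_dim f \<le> hausdorff_dim (julia_set f)" .
qed

end
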